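(* Let $\mathcal{G}$ be the network of a (constrained) system and let $\mathcal{G}_E$ be its expanded network. A shortest path from a source to a sink in $\mathcal{G}_E$ corresponds to a shortest feasible path in $\mathcal{G}$. That is, if $p_E$ is a path in $\mathcal{G}_E$ from a source node $i^0$ ($i\in\mathcal{S}$) to a sink node $j^c$ ($j\in\mathcal{T}$, $0\le c\le C_{max}$) having minimum length among all paths in $\mathcal{G}_E$ from $i^0$ to sink nodes of $\mathcal{G}_E$, then the corresponding node sequence in $\mathcal{G}$ is a feasible path (with no repeated nodes) of minimum length among all feasible paths in $\mathcal{G}$ from $i$ to the sinks $\mathcal{T}$.
   Context: **Network.** $\mathcal{G}=(\mathcal{N},\mathcal{A})$ is a finite directed network with nodes $\mathcal{N}=\{1,\dots,n\}$, arcs $\mathcal{A}\subseteq\mathcal{N}^2$, source nodes $\mathcal{S}\subseteq\mathcal{N}$ and sink nodes $\mathcal{T}\subseteq\mathcal{N}$, $\mathcal{T}\cap\mathcal{S}=\emptyset$. Each arc $(i,j)$ has an integer cost $\gamma_{ij}\in\mathbb{Z}$ and an integer secondary cost $\sigma_{ij}$, with $\sigma_{ij}\ge0$. $C_{max}\in\mathbb{N}$ is given. A path is an ordered sequence of non-repeating nodes $h_1,\dots,h_r$ with $(h_s,h_{s+1})\in\mathcal{A}$; it is a walk if some nodes are repeated; a circuit if only the first and last nodes coincide. For a path, walk or circuit $p$, the length is $L(p)=\sum_s\gamma_{h_sh_{s+1}}$ and the secondary cost is $C(p)=\sum_s\sigma_{h_sh_{s+1}}$. A path (or walk) is feasible if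 $C(p)\le C_{max}$ and the same holds for all its initial subpaths (automatic when $\sigma_{ij}\ge0$). **Standing assumptions.** $\mathcal{G}$ is weakly connected; from each source there is at least one feasible path to a sink; every circuit $\varphi$ has $L(\varphi)>0$ and $C(\varphi)\ge0$; $\gamma_{ij}\le\bar\gamma$ and $\sigma_{ij}\le\bar\sigma$ for all arcs; there are no paths of negative length between any pair of sinks. **Expanded network.** $\mathcal{G}_E=(\mathcal{N}_E,\mathcal{A}_E)$ has nodes $\mathcal{N}_E=\{i^c: i\in\mathcal{N},\ c\in\{0,\dots,C_{max}\}\}$ and, for each $(i,j)\in\mathcal{A}$ and each $c\in\{0,\dots,C_{max}-\sigma_{ij}\}$, an arc $(i^c,j^{c+\sigma_{ij}})\in\mathcal{A}_E$ with cost $\gamma_{ij}$. Its sources are the nodes $i^0$ with $i\in\mathcal{S}$; its sinks are the nodes $j^c$ with $j\in\mathcal{T}$, $0\le c\le C_{max}$. No secondary-cost constraint is imposed on paths in $\mathcal{G}_E$. A path $h_1^{c_1},\dots,h_r^{c_r}$ in $\mathcal{G}_E$ with $c_1=0$ corresponds to the node sequence $h_1,\dots,h_r$ in $\mathcal{G}$, which is a feasible path or walk of the same length. *)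

theory Defs
  imports
    "Graph_Theory.Digraph_Component"
    "Graph_Theory.Vertex_Walk"
    "HOL-Library.Sublist"
begin

text \<open>
  Walks are nonempty node sequences (\<^const>\<open>vwalk\<close>) and paths are walks without repeated
  nodes (\<^const>\<open>vpath\<close>). A single node is a path, of length 0.
\<close>

definition walk_weight :: "('a \<times> 'a \<Rightarrow> int) \<Rightarrow> 'a list \<Rightarrow> int" where
  "walk_weight w p = sum_list (map w (vwalk_arcs p))"

text \<open>Loops, and pairs of opposite arcs, count as circuits.\<close>

definition circuit :: "'a pair_pre_digraph \<Rightarrow> 'a list \<Rightarrow> bool" where
  "circuit G p \<longleftrightarrow> vwalk p G \<and> length p \<ge> 2 \<and> hd p = last p \<and> distinct (butlast p)"

definition within_budget :: "('a \<times> 'a \<Rightarrow> int) \<Rightarrow> nat \<Rightarrow> 'a list \<Rightarrow> bool" where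
  "within_budget \<sigma> Cmax p \<longleftrightarrow>
     walk_weight \<sigma> p \<le> int Cmax \<and>
     (\<forall>q. q \<noteq> [] \<and> prefix q p \<longrightarrow> walk_weight \<sigma> q \<le> int Cmax)"

definition paths_to :: "'a pair_pre_digraph \<Rightarrow> 'a \<Rightarrow> 'a set \<Rightarrow> 'a list set" where
  "paths_to G i T = {p. vpath p G \<and> hd p = i \<and> last p \<in> T}"

definition feasible_paths_to ::
    "'a pair_pre_digraph \<Rightarrow> ('a \<times> 'a \<Rightarrow> int) \<Rightarrow> nat \<Rightarrow> 'a \<Rightarrow> 'a set \<Rightarrow> 'a list set" where
  "feasible_paths_to G \<sigma> Cmax i T = {p \<in> paths_to G i T. within_budget \<sigma> Cmax p}"

definition shortest_in :: "('a \<times> 'a \<Rightarrow> int) \<Rightarrow> 'a list set \<Rightarrow> 'a list \<Rightarrow> bool" where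
  "shortest_in \<gamma> P p \<longleftrightarrow> is_arg_min (walk_weight \<gamma>) (\<lambda>q. q \<in> P) p"

locale constrained_network = pair_fin_digraph G
  for G :: "nat pair_pre_digraph" +
  fixes n :: nat
    and S T :: "nat set"
    and \<gamma> \<sigma> :: "nat \<times> nat \<Rightarrow> int"
    and Cmax :: nat
    and \<gamma>bar \<sigma>bar :: int
  assumes nodes: "pverts G = {1..n}"
    and sources: "S \<subseteq> pverts G"
    and sinks: "T \<subseteq> pverts G"
    and disjoint: "T \<inter> S = {}"
    and secondary_nonneg: "\<And>a. a \<in> parcs G \<Longrightarrow> 0 \<le> \<sigma> a"
    and cost_bound: "\<And>a. a \<in> parcs G \<Longrightarrow> \<gamma> a \<le> \<gamma>bar"
    and secondary_bound: "\<And>a. a \<in> parcs G \<Longrightarrow> \<sigma> a \<le> \<sigma>bar"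
    and weakly_connected: "connected G"
    and feasible: "\<And>i. i \<in> S \<Longrightarrow> feasible_paths_to G \<sigma> Cmax i T \<noteq> {}"
    and circuit_length: "\<And>p. circuit G p \<Longrightarrow> 0 < walk_weight \<gamma> p"
    and circuit_secondary: "\<And>p. circuit G p \<Longrightarrow> 0 \<le> walk_weight \<sigma> p"
    and sink_to_sink: "\<And>j p. j \<in> T \<Longrightarrow> p \<in> paths_to G j T \<Longrightarrow> 0 \<le> walk_weight \<gamma> p"

text \<open>The pair \<open>(i, c)\<close> stands for the node \<open>i\<close> at accumulated secondary cost \<open>c\<close>.\<close>

definition expanded_network ::
    "'a pair_pre_digraph \<Rightarrow> ('a \<times> 'a \<Rightarrow> int) \<Rightarrow> nat \<Rightarrow> ('a \<times> int) pair_pre_digraph" where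
  "expanded_network G \<sigma> Cmax =
     \<lparr> pverts = pverts G \<times> {0..int Cmax},
       parcs = {((i, c), (j, c + \<sigma> (i, j))) | i j c.
                  (i, j) \<in> parcs G \<and> c \<in> {0..int Cmax - \<sigma> (i, j)}} \<rparr>"

definition expanded_cost ::
    "('a \<times> 'a \<Rightarrow> int) \<Rightarrow> ('a \<times> int) \<times> ('a \<times> int) \<Rightarrow> int" where
  "expanded_cost \<gamma> = (\<lambda>(u, v). \<gamma> (fst u, fst v))"

definition expanded_sinks :: "'a set \<Rightarrow> nat \<Rightarrow> ('a \<times> int) set" where
  "expanded_sinks T Cmax = T \<times> {0..int Cmax}"

end

theory Submission
  imports Defs
begin

text \<open>
  A path of the expanded network from \<open>(i, 0)\<close> projects to a walk of equal length whose secondary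
  cost is the second component of its last node, hence is within budget; conversely every feasible
  path lifts to a path of the expanded network by recording accumulated secondary costs. If the
  projection of a shortest path repeated a node, deleting circuits, which have positive length and
  nonnegative secondary cost, would give a strictly shorter feasible path, whose lift
  contradicts minimality.
\<close>

lemma walk_weight_simps [simp]:
  "walk_weight w [] = 0"
  "walk_weight w [x] = 0"
  "walk_weight w (x # y # p) = w (x, y) + walk_weight w (y # p)"
  by (simp_all add: walk_weight_def)

text \<open>Both pieces contain the node \<open>y\<close>, so every arc is counted exactly
  once.\<close>

lemma walk_weight_append:
  "walk_weight w (xs @ y # ys) = walk_weight w (xs @ [y]) + walk_weight w (y # ys)"
  by (induction xs rule: induct_list012) auto

lemma vwalk_Cons_Cons_iff:
  fixes G :: "'a pair_pre_digraph"
  shows "vwalk (x # y # p) G \<longleftrightarrow> x \<in> pverts G \<and> (x, y) \<in> parcs G \<and> vwalk (y # p) G"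
  by (auto simp: vwalk_def)

lemma vwalk_singleton_iff:
  fixes G :: "'a pair_pre_digraph"
  shows "vwalk [x] G \<longleftrightarrow> x \<in> pverts G"
  by (auto simp: vwalk_def)

lemma walk_weight_nonneg:
  fixes G :: "'a pair_pre_digraph"
  assumes "vwalk p G" and "\<And>a. a \<in> parcs G \<Longrightarrow> 0 \<le> w a"
  shows "0 \<le> walk_weight w p"
  using assms by (fastforce simp: walk_weight_def vwalk_def intro!: sum_list_nonneg)

lemma walk_weight_prefix_le:
  fixes G :: "'a pair_pre_digraph"
  assumes "vwalk p G" and "\<And>a. a \<in> parcs G \<Longrightarrow> 0 \<le> w a" and "prefix q p"
  shows "walk_weight w q \<le> walk_weight w p"
proof (cases q rule: rev_cases)
  case Nil
  then show ?thesis using walk_weight_nonneg[OF assms(1,2)] by simp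
next
  case (snoc xs x)
  then obtain r where p: "p = xs @ x # r" using assms(3) by (auto simp: prefix_def)
  have "vwalk (x # r) G" using assms(1) p by (auto intro: vwalkI_append_r)
  then have "0 \<le> walk_weight w (x # r)" using assms(2) by (rule walk_weight_nonneg)
  \<comment> \<open>Occurrence 2 is the right-hand side; the other match is \<open>xs @ [x]\<close>,
    whose split would be trivial.\<close>
  then show ?thesis unfolding snoc p by (subst (2) walk_weight_append) simp
qed

text \<open>Nonnegative secondary costs make the weight monotone along prefixes, so the bound on the
  whole walk implies the bound on each initial subwalk.\<close>

lemma within_budget_iff:
  fixes G :: "'a pair_pre_digraph"
  assumes "vwalk p G" and "\<And>a. a \<in> parcs G \<Longrightarrow> 0 \<le> \<sigma> a"
  shows "within_budget \<sigma> Cmax p \<longleftrightarrow> walk_weight \<sigma> p \<le> int Cmax"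
  using walk_weight_prefix_le[OF assms] by (force simp: within_budget_def)

text \<open>Induction from the end: once the tail is reduced to a path, prepending \<open>x\<close>
  can repeat only \<open>x\<close>, so a single circuit has to be cut. Two weights are tracked:
  \<open>v\<close> must drop strictly to contradict minimality, while \<open>w\<close> must merely
  not rise, to stay within budget.\<close>

lemma vwalk_shortcut:
  fixes G :: "'a pair_pre_digraph"
  assumes "vwalk p G"
    and pos: "\<And>c. circuit G c \<Longrightarrow> 0 < walk_weight v c"
    and nonneg: "\<And>c. circuit G c \<Longrightarrow> 0 \<le> walk_weight w c"
  shows "\<exists>q. vpath q G \<and> hd q = hd p \<and> last q = last p \<and> walk_weight w q \<le> walk_weight w p \<and>
    (q = p \<or> walk_weight v q < walk_weight v p)"
  using assms(1)
proof (induction p rule: induct_list012)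
  case 1
  then show ?case by (simp add: vwalk_def)
next
  case (2 x)
  then show ?case by (intro exI[of _ "[x]"]) (simp add: vpath_def)
next
  case (3 x y p)
  then have x: "x \<in> pverts G" "(x, y) \<in> parcs G" and "vwalk (y # p) G"
    by (simp_all add: vwalk_Cons_Cons_iff)
  with "3.IH"(2) obtain q where q: "vpath q G" "hd q = y" "last q = last (y # p)"
    "walk_weight w q \<le> walk_weight w (y # p)"
    "q = y # p \<or> walk_weight v q < walk_weight v (y # p)"
    by auto
  then obtain q' where q': "q = y # q'" by (cases q) (auto simp: vpath_def vwalk_def)
  have walk: "vwalk (x # q) G" using x q(1) q' by (simp add: vwalk_Cons_Cons_iff vpath_def)
  show ?case
  proof (cases "x \<in> set q")
    case False
    then show ?thesis
      using q q' walk by (intro exI[of _ "x # q"]) (auto simp: vpath_def)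
  next
    case True
    \<comment> \<open>Since \<open>q\<close> starts with \<open>y\<close>, \<open>as\<close> is
      empty exactly if \<open>x = y\<close>; the circuit \<open>[x, x]\<close> is then a
      loop.\<close>
    then obtain as bs where split: "q = as @ x # bs" by (auto simp: in_set_conv_decomp)
    have "vwalk ((x # as @ [x]) @ bs) G" using walk split by simp
    then have "vwalk (x # as @ [x]) G" by (rule vwalkI_append_l[rotated]) simp
    moreover have "distinct (x # as)" using q(1) split by (auto simp: vpath_def)
    ultimately have circ: "circuit G (x # as @ [x])" by (simp add: circuit_def butlast_append)
    have split_weight: "walk_weight u (x # q) = walk_weight u (x # as @ [x]) + walk_weight u (x # bs)" for u
      using walk_weight_append[of u "x # as" x bs] split by simp
    have path: "vpath (x # bs) G"
      using q(1) split by (auto simp: vpath_def intro: vwalkI_append_r)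
    have "last (x # bs) = last (x # y # p)" using q(3) split by simp
    moreover have "walk_weight w (x # bs) \<le> walk_weight w (x # y # p)"
      using split_weight[of w] nonneg[OF circ] q(4) q' by simp
    \<comment> \<open>Even if \<open>q\<close> is the unchanged tail, the removed circuit makes the
      inequality strict.\<close>
    moreover have "walk_weight v (x # bs) < walk_weight v (x # y # p)"
      using split_weight[of v] pos[OF circ] q(5) q' by auto
    ultimately show ?thesis using path by (intro exI[of _ "x # bs"]) simp
  qed
qed

lemma walk_weight_expanded_cost:
  "walk_weight (expanded_cost \<gamma>) p = walk_weight \<gamma> (map fst p)"
  by (induction p rule: induct_list012) (auto simp: expanded_cost_def)

lemma expanded_network_simps:
  "(x, c) \<in> pverts (expanded_network G \<sigma> Cmax) \<longleftrightarrow> x \<in> pverts G \<and> 0 \<le> c \<and> c \<le> int Cmax"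
  "((x, c), (y, d)) \<in> parcs (expanded_network G \<sigma> Cmax) \<longleftrightarrow>
     (x, y) \<in> parcs G \<and> 0 \<le> c \<and> d \<le> int Cmax \<and> d = c + \<sigma> (x, y)"
  by (auto simp: expanded_network_def)

text \<open>The second components telescope: each arc raises them by the secondary cost of its
  projection. The starting level is arbitrary because the induction passes to the tail.\<close>

lemma vwalk_map_fst_expanded:
  fixes G :: "'a pair_pre_digraph"
  assumes "vwalk p (expanded_network G \<sigma> Cmax)"
  shows "vwalk (map fst p) G \<and> snd (last p) = snd (hd p) + walk_weight \<sigma> (map fst p)"
  using assms
proof (induction p rule: induct_list012)
  case 1
  then show ?case by (simp add: vwalk_def)
next
  case (2 x)
  then show ?case by (cases x) (simp add: vwalk_singleton_iff expanded_network_simps)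
next
  case (3 x y p)
  then show ?case
    by (cases x; cases y) (auto simp: vwalk_Cons_Cons_iff expanded_network_simps)
qed

text \<open>A right inverse of \<open>map fst\<close>; the level \<open>c\<close> is a parameter
  because the recursive call continues at the level already reached.\<close>

fun lift_walk :: "('a \<times> 'a \<Rightarrow> int) \<Rightarrow> int \<Rightarrow> 'a list \<Rightarrow> ('a \<times> int) list" where
  "lift_walk \<sigma> c [] = []"
| "lift_walk \<sigma> c [x] = [(x, c)]"
| "lift_walk \<sigma> c (x # y # p) = (x, c) # lift_walk \<sigma> (c + \<sigma> (x, y)) (y # p)"

lemma map_fst_lift_walk [simp]: "map fst (lift_walk \<sigma> c p) = p"
  by (induction \<sigma> c p rule: lift_walk.induct) auto

lemma lift_walk_eq_Nil_iff [simp]: "lift_walk \<sigma> c p = [] \<longleftrightarrow> p = []"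
  by (cases "(\<sigma>, c, p)" rule: lift_walk.cases) auto

lemma hd_lift_walk: "p \<noteq> [] \<Longrightarrow> hd (lift_walk \<sigma> c p) = (hd p, c)"
  by (cases "(\<sigma>, c, p)" rule: lift_walk.cases) auto

lemma last_lift_walk: "p \<noteq> [] \<Longrightarrow> last (lift_walk \<sigma> c p) = (last p, c + walk_weight \<sigma> p)"
  by (induction \<sigma> c p rule: lift_walk.induct) auto

text \<open>Levels never decrease along the lift, so it stays inside the expanded network once its
  first level is nonnegative and its last is at most \<open>Cmax\<close>.\<close>

lemma vwalk_lift_walk:
  fixes G :: "'a pair_pre_digraph"
  assumes "vwalk p G" and "\<And>a. a \<in> parcs G \<Longrightarrow> 0 \<le> \<sigma> a"
    and "0 \<le> c" and "c + walk_weight \<sigma> p \<le> int Cmax"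
  shows "vwalk (lift_walk \<sigma> c p) (expanded_network G \<sigma> Cmax)"
  using assms
proof (induction \<sigma> c p rule: lift_walk.induct)
  case (1 \<sigma> c)
  then show ?case by (simp add: vwalk_def)
next
  case (2 \<sigma> c x)
  then show ?case by (simp add: vwalk_singleton_iff expanded_network_simps)
next
  case (3 \<sigma> c x y p)
  let ?d = "c + \<sigma> (x, y)"
  have walk: "x \<in> pverts G" "(x, y) \<in> parcs G" "vwalk (y # p) G"
    using "3.prems"(1) by (simp_all add: vwalk_Cons_Cons_iff)
  have bounds: "0 \<le> \<sigma> (x, y)" "0 \<le> walk_weight \<sigma> (y # p)"
    using walk "3.prems"(2) walk_weight_nonneg by blast+
  have IH: "vwalk (lift_walk \<sigma> ?d (y # p)) (expanded_network G \<sigma> Cmax)"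
    using walk bounds "3.prems" by (intro "3.IH") auto
  \<comment> \<open>The lifted tail is opened to expose its first node, the head of the new arc from
    \<open>(x, c)\<close>.\<close>
  obtain r where "lift_walk \<sigma> ?d (y # p) = (y, ?d) # r"
    using hd_lift_walk[of "y # p" \<sigma> ?d] by (cases "lift_walk \<sigma> ?d (y # p)") auto
  moreover have "c \<le> int Cmax" using bounds "3.prems"(4) by simp
  ultimately show ?case
    using IH walk bounds "3.prems" by (simp add: vwalk_Cons_Cons_iff expanded_network_simps)
qed

lemma lift_walk_in_paths_to:
  assumes "q \<in> feasible_paths_to G \<sigma> Cmax i T" and "\<And>a. a \<in> parcs G \<Longrightarrow> 0 \<le> \<sigma> a"
  shows "lift_walk \<sigma> 0 q \<in>
    paths_to (expanded_network G \<sigma> Cmax) (i, 0) (expanded_sinks T Cmax)"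
proof -
  have q: "vwalk q G" "q \<noteq> []" "distinct q" "hd q = i" "last q \<in> T" "walk_weight \<sigma> q \<le> int Cmax"
    using assms(1)
    by (auto simp: feasible_paths_to_def paths_to_def within_budget_def vpath_def)
  have "0 \<le> walk_weight \<sigma> q" using q(1) assms(2) by (rule walk_weight_nonneg)
  \<comment> \<open>A node repeated in the lift would repeat its first component in
    \<open>q\<close>.\<close>
  moreover have "distinct (lift_walk \<sigma> 0 q)"
    using q(3) by (metis distinct_map map_fst_lift_walk)
  ultimately show ?thesis
    using q vwalk_lift_walk[where \<sigma> = \<sigma> and c = 0 and Cmax = Cmax, OF q(1) assms(2)]
    by (simp add: paths_to_def vpath_def expanded_sinks_def hd_lift_walk last_lift_walk)
qed

theorem theorem6:
  fixes G :: "nat pair_pre_digraph"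
    and n Cmax :: nat
    and S T :: "nat set"
    and \<gamma> \<sigma> :: "nat \<times> nat \<Rightarrow> int"
    and \<gamma>bar \<sigma>bar :: int
    and i :: nat
    and pE :: "(nat \<times> int) list"
  assumes "constrained_network G n S T \<gamma> \<sigma> Cmax \<gamma>bar \<sigma>bar"
    and "i \<in> S"
    and "shortest_in (expanded_cost \<gamma>)
           (paths_to (expanded_network G \<sigma> Cmax) (i, 0) (expanded_sinks T Cmax)) pE"
  shows "shortest_in \<gamma> (feasible_paths_to G \<sigma> Cmax i T) (map fst pE)"
proof -
  interpret constrained_network G n S T \<gamma> \<sigma> Cmax \<gamma>bar \<sigma>bar by (rule assms(1))
  let ?P = "paths_to (expanded_network G \<sigma> Cmax) (i, 0) (expanded_sinks T Cmax)"
  let ?p = "map fst pE"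
  have pE: "vwalk pE (expanded_network G \<sigma> Cmax)" "hd pE = (i, 0)"
      "fst (last pE) \<in> T" "snd (last pE) \<le> int Cmax"
    using assms(3)
    by (auto simp: shortest_in_def is_arg_min_def paths_to_def vpath_def expanded_sinks_def)
  then have nonempty: "pE \<noteq> []" by (auto simp: vwalk_def)
  have p: "vwalk ?p G" "hd ?p = i" "last ?p \<in> T" "walk_weight \<sigma> ?p \<le> int Cmax"
    using vwalk_map_fst_expanded[OF pE(1)] pE nonempty by (auto simp: hd_map last_map)
  \<comment> \<open>\<open>?p\<close> is not yet known to be a path; the comparison goes through the
    lift of \<open>q\<close>, which competes with \<open>pE\<close>.\<close>
  have min: "walk_weight \<gamma> ?p \<le> walk_weight \<gamma> q" if "q \<in> feasible_paths_to G \<sigma> Cmax i T" for q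
    using lift_walk_in_paths_to[OF that secondary_nonneg] assms(3)
    by (force simp: shortest_in_def is_arg_min_linorder walk_weight_expanded_cost)
  \<comment> \<open>Here \<open>v\<close> is \<open>\<gamma>\<close> and \<open>w\<close> is
    \<open>\<sigma>\<close>: cutting circuits keeps \<open>q\<close> within budget.\<close>
  obtain q where q: "vpath q G" "hd q = i" "last q \<in> T" "walk_weight \<sigma> q \<le> int Cmax"
      "q = ?p \<or> walk_weight \<gamma> q < walk_weight \<gamma> ?p"
    using vwalk_shortcut[OF p(1) circuit_length circuit_secondary] p by fastforce
  then have feas: "q \<in> feasible_paths_to G \<sigma> Cmax i T"
    using within_budget_iff[where \<sigma> = \<sigma>, OF _ secondary_nonneg]
    by (auto simp: feasible_paths_to_def paths_to_def vpath_def)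
  \<comment> \<open>A strictly shorter feasible \<open>q\<close> would contradict
    \<open>min\<close>, so \<open>?p\<close> itself is the path.\<close>
  with min q(5) have "q = ?p" by fastforce
  with feas min show ?thesis by (auto simp: shortest_in_def is_arg_min_linorder)
qed

end
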